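(* Let $q$ be a real number. Then the action of the exotic isometry $\Phi^q$ of $\mathcal{W}_2(\mathbb{R})$ is given by the following formula: for all $\mu\in\mathcal{W}_2(\mathbb{R})$ and $0<x<1$, $$F^{-1}_{\Phi^q(\mu)}(x)=(1-e^q)\, m(\mu)+\left\{e^q+(e^{-q}-e^q)h_q(x)\right\} F^{-1}_\mu(h_q(x))+(e^{q}-e^{-q})\int_0^{h_q(x)}F^{-1}_\mu(s)\,ds,$$ where $$h_q(x)=\frac{x e^{2q}}{1+(e^{2q}-1)x}\qquad(x\in(0,1)).$$
   Context: $\mathcal{W}_2(\mathbb{R})$ is the set of Borel probability measures $\mu$ on $\mathbb{R}$ with $\int x^2\,d\mu(x)<\infty$, with the quadratic Wasserstein distance $d_{\mathcal{W}_2}(\mu,\nu)=\left(\inf_{\pi}\int |x-y|^2\,d\pi(x,y)\right)^{1/2}$, the infimum being over all couplings $\pi$ of $\mu$ and $\nu$. The quantile function of $\mu$ is $F_\mu^{-1}:(0,1)\to\mathbb{R}$, $F_\mu^{-1}(y)=\sup\{x\in\mathbb{R}\mid \mu((-\infty,x])\le y\}$; one has $d_{\mathcal{W}_2}(\mu,\nu)=\|F_\mu^{-1}-F_\nu^{-1}\|_{L^2((0,1))}$. The center of mass of $\mu$ is $m(\mu)=\int_0^1F_\mu^{-1}(x)\,dx$. The set $\Delta_2(\mathbb{R})$ of measures supported on at most two points is parametrized by $x,p\in\mathbb{R}$, $\sigma\ge0$ as $$\mu(x,\sigma,p)=\frac{e^{-p}}{e^p+e^{-p}}\,\delta_{x-\sigma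 e^p}+\frac{e^{p}}{e^p+e^{-p}}\,\delta_{x+\sigma e^{-p}}.$$ For $q\in\mathbb{R}$, the exotic isometry $\Phi^q$ is defined on $\Delta_2(\mathbb{R})$ by $\Phi^q(\mu(x,\sigma,p))=\mu(x,\sigma,p+q)$. By a result of Kloeckner (2010) this is an isometry of $\Delta_2(\mathbb{R})$ which extends uniquely to an isometry (surjective distance preserving map) of $\mathcal{W}_2(\mathbb{R})$; this extension is also denoted by $\Phi^q$. *)

theory Defs
  imports "HOL-Probability.Probability"
begin

definition wasserstein_space :: "real measure set"  (\<open>\<W>\<^sub>2\<close>) where
  "\<W>\<^sub>2 = {\<mu>. real_distribution \<mu> \<and> integrable \<mu> (\<lambda>x. x\<^sup>2)}"

definition couplings :: "real measure \<Rightarrow> real measure \<Rightarrow> (real \<times> real) measure set" where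
  "couplings \<mu> \<nu> =
     {\<pi>. prob_space \<pi> \<and> sets \<pi> = sets (borel \<Otimes>\<^sub>M borel) \<and>
         distr \<pi> borel fst = \<mu> \<and> distr \<pi> borel snd = \<nu>}"

text \<open>For \<open>\<mu>, \<nu> \<in> \<W>\<^sub>2\<close> every coupling has finite cost and the product measure is a coupling,
  so neither the Bochner integral nor the real-valued infimum takes a default value.\<close>

definition wasserstein_dist :: "real measure \<Rightarrow> real measure \<Rightarrow> real" where
  "wasserstein_dist \<mu> \<nu> =
     sqrt (INF \<pi>\<in>couplings \<mu> \<nu>. (\<integral>(x, y). \<bar>x - y\<bar>\<^sup>2 \<partial>\<pi>))"

text \<open>Only meaningful for arguments in the open unit interval.\<close>

definition quantile :: "real measure \<Rightarrow> real \<Rightarrow> real" where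
  "quantile \<mu> y = Sup {x. measure \<mu> {..x} \<le> y}"

definition center_of_mass :: "real measure \<Rightarrow> real" where
  "center_of_mass \<mu> = (LBINT s:{0<..<1}. quantile \<mu> s)"

text \<open>The convex combination of two Dirac measures with weights \<open>exp (-p) / (exp p + exp (-p))\<close>
  and \<open>exp p / (exp p + exp (-p))\<close>; it lies in \<open>\<Delta>\<^sub>2(\<real>)\<close> when \<open>\<sigma> \<ge> 0\<close>.\<close>

definition two_point :: "real \<Rightarrow> real \<Rightarrow> real \<Rightarrow> real measure" where
  "two_point x \<sigma> p = measure_of UNIV (sets borel)
     (\<lambda>A. ennreal (exp (-p) / (exp p + exp (-p))) * emeasure (return borel (x - \<sigma> * exp p)) A
        + ennreal (exp p / (exp p + exp (-p))) * emeasure (return borel (x + \<sigma> * exp (-p))) A)"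

lemma sets_two_point [simp]: "sets (two_point x \<sigma> p) = sets borel"
  unfolding two_point_def
  using sets.sets_measure_of_eq[of "borel :: real measure"] by (simp only: space_borel)

lemma emeasure_two_point:
  assumes "A \<in> sets borel"
  shows "emeasure (two_point x \<sigma> p) A =
      ennreal (exp (-p) / (exp p + exp (-p))) * emeasure (return borel (x - \<sigma> * exp p)) A
    + ennreal (exp p / (exp p + exp (-p))) * emeasure (return borel (x + \<sigma> * exp (-p))) A"
proof (rule emeasure_measure_of[OF two_point_def])
  show "countably_additive (sets (two_point x \<sigma> p)) (\<lambda>A.
      ennreal (exp (-p) / (exp p + exp (-p))) * emeasure (return borel (x - \<sigma> * exp p)) A
    + ennreal (exp p / (exp p + exp (-p))) * emeasure (return borel (x + \<sigma> * exp (-p))) A)"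
  proof (intro countably_additiveI, goal_cases)
    case (1 B)
    have *: "(\<Sum>i. c * emeasure (return borel a) (B i)) = c * emeasure (return borel a) (\<Union>i. B i)"
      for c :: ennreal and a :: real
      using 1 by (simp only: ennreal_suminf_cmult) (subst suminf_emeasure, auto)
    show ?case
      by (subst suminf_add[symmetric]) (simp_all only: * summableI)
  qed
qed (use assms in \<open>auto simp: positive_def\<close>)

definition isometry_W2 :: "(real measure \<Rightarrow> real measure) \<Rightarrow> bool" where
  "isometry_W2 \<Phi> \<longleftrightarrow> \<Phi> ` \<W>\<^sub>2 = \<W>\<^sub>2 \<and>
     (\<forall>\<mu>\<in>\<W>\<^sub>2. \<forall>\<nu>\<in>\<W>\<^sub>2. wasserstein_dist (\<Phi> \<mu>) (\<Phi> \<nu>) = wasserstein_dist \<mu> \<nu>)"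

text \<open>By Kloeckner (2010) there is, up to values outside \<open>\<W>\<^sub>2\<close>, exactly one such \<open>\<Phi>\<close> for
  each \<open>q\<close>; \<open>exotic_isometry q \<Phi>\<close> says that \<open>\<Phi>\<close> is the map called \<open>\<Phi>\<^sup>q\<close>.\<close>

definition exotic_isometry :: "real \<Rightarrow> (real measure \<Rightarrow> real measure) \<Rightarrow> bool" where
  "exotic_isometry q \<Phi> \<longleftrightarrow> isometry_W2 \<Phi> \<and>
     (\<forall>x \<sigma> p. \<sigma> \<ge> 0 \<longrightarrow> \<Phi> (two_point x \<sigma> p) = two_point x \<sigma> (p + q))"

definition hq :: "real \<Rightarrow> real \<Rightarrow> real" where
  "hq q x = x * exp (2 * q) / (1 + (exp (2 * q) - 1) * x)"

end

theory Submission
  imports Defs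
begin

text \<open>The distance from \<open>\<mu>\<close> to a measure with at most two atoms is determined by the mean of \<open>\<mu>\<close>, the
  \<open>L\<^sup>2\<close> norm of its quantile function \<open>F\<close>, and the partial integral of \<open>F\<close> over \<open>(0, t)\<close>, where \<open>t\<close> is the
  mass of the left atom. Since \<open>\<Phi>\<^sup>q\<close> acts explicitly on such measures and preserves distances, it
  preserves the mean and the norm, and the integral of the quantile function of \<open>\<Phi>\<^sup>q(\<mu>)\<close> over \<open>(0, x)\<close>
  is an explicit function of that of \<open>F\<close> over \<open>(0, h\<^sub>q(x))\<close>. Quantile functions are right-continuous,
  so taking right derivatives in \<open>x\<close> gives the formula at every point.\<close>

section \<open>Quantile functions\<close>

text \<open>Restricted to the open unit interval, Lebesgue measure is a probability measure, so
  quantile functions become random variables on it.\<close>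

definition unit_lborel :: "real measure" where
  "unit_lborel = restrict_space lborel {0<..<1}"

lemma space_unit_lborel: "space unit_lborel = {0<..<1}"
  by (simp add: unit_lborel_def space_restrict_space)

lemma emeasure_unit_lborel: "A \<subseteq> {0<..<1} \<Longrightarrow> emeasure unit_lborel A = emeasure lborel A"
  by (simp add: unit_lborel_def emeasure_restrict_space)

lemma measure_unit_lborel: "A \<subseteq> {0<..<1} \<Longrightarrow> measure unit_lborel A = measure lborel A"
  by (simp add: unit_lborel_def measure_restrict_space)

lemma sets_unit_lborel: "A \<in> sets unit_lborel \<longleftrightarrow> A \<subseteq> {0<..<1} \<and> A \<in> sets borel"
  by (auto simp: unit_lborel_def sets_restrict_space_iff)

lemma measurable_unit_lborel: "f \<in> borel_measurable borel \<Longrightarrow> f \<in> borel_measurable unit_lborel"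
  unfolding unit_lborel_def by (rule measurable_restrict_space1) simp

lemma integral_unit_lborel:
  fixes f :: "real \<Rightarrow> real"
  shows "integral\<^sup>L unit_lborel f = (LBINT s:{0<..<1}. f s)"
  unfolding unit_lborel_def set_lebesgue_integral_def by (rule integral_restrict_space) simp

lemma integrable_unit_lborel:
  fixes f :: "real \<Rightarrow> real"
  shows "integrable unit_lborel f \<longleftrightarrow> set_integrable lborel {0<..<1} f"
  unfolding unit_lborel_def set_integrable_def by (rule integrable_restrict_space) simp

interpretation unit_lborel: prob_space unit_lborel
  by (rule prob_spaceI) (simp add: space_unit_lborel emeasure_unit_lborel)

section \<open>The quantile function as a generalized inverse of the distribution function\<close>

context real_distribution
begin

text \<open>\<open>Sup\<close> on the reals is meaningful only for nonempty sets bounded above; the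
  limits of the cdf at both infinities supply this for levels strictly between 0 and 1.\<close>

lemma quantile_set:
  assumes "0 < y" "y < 1"
  shows "{x. cdf M x \<le> y} \<noteq> {}" "bdd_above {x. cdf M x \<le> y}"
proof -
  have "\<forall>\<^sub>F x in at_bot. cdf M x < y"
    using order_tendstoD(2)[OF cdf_lim_at_bot assms(1)] .
  then obtain x where "cdf M x < y"
    by (auto simp: eventually_at_bot_linorder)
  then show "{x. cdf M x \<le> y} \<noteq> {}"
    using less_imp_le by blast
  have "\<forall>\<^sub>F x in at_top. y < cdf M x"
    using order_tendstoD(1)[OF cdf_lim_at_top_prob assms(2)] .
  then obtain z where z: "\<And>x. x \<ge> z \<Longrightarrow> y < cdf M x"
    by (auto simp: eventually_at_top_linorder)
  show "bdd_above {x. cdf M x \<le> y}"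
  proof (rule bdd_aboveI)
    fix x assume "x \<in> {x. cdf M x \<le> y}"
    then show "x \<le> z"
      using z[of x] by (cases "z \<le> x") auto
  qed
qed

lemma quantile_eq_Sup_cdf: "quantile M y = Sup {x. cdf M x \<le> y}"
  by (simp add: quantile_def cdf_def)

text \<open>Strictness matters: where the cdf is flat to the right of \<open>x\<close>, the quantile
  at level \<open>cdf M x\<close> lies beyond \<open>x\<close>. So there is no exact Galois
  connection, only this lemma and the next two.\<close>

lemma quantile_le_of_less_cdf:
  assumes "0 < y" "y < 1" "y < cdf M x"
  shows "quantile M y \<le> x"
  unfolding quantile_eq_Sup_cdf
proof (rule cSup_least[OF quantile_set(1)[OF assms(1,2)]])
  fix z assume "z \<in> {x. cdf M x \<le> y}"
  with assms(3) have "cdf M z < cdf M x" by simp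
  then show "z \<le> x"
    using cdf_nondecreasing[of x z] by (meson not_le nle_le)
qed

lemma less_cdf_of_quantile_less:
  assumes "0 < y" "y < 1" "quantile M y < x"
  shows "y < cdf M x"
proof (rule ccontr)
  assume "\<not> y < cdf M x"
  then have "x \<le> quantile M y"
    unfolding quantile_eq_Sup_cdf
    by (intro cSup_upper quantile_set(2)[OF assms(1,2)]) auto
  with assms(3) show False by simp
qed

text \<open>The previous lemma gives the strict inequality at every \<open>z > x\<close>; right
  continuity of the cdf carries it, weakened, to \<open>x\<close>.\<close>

lemma le_cdf_of_quantile_le:
  assumes "0 < y" "y < 1" "quantile M y \<le> x"
  shows "y \<le> cdf M x"
proof (rule tendsto_lowerbound)
  show "(cdf M \<longlongrightarrow> cdf M x) (at_right x)"
    using cdf_is_right_cont[of x] by (simp add: continuous_within)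
  show "\<forall>\<^sub>F z in at_right x. y \<le> cdf M z"
    using eventually_at_right_less[of x]
  proof eventually_elim
    case (elim z)
    then show ?case
      using less_cdf_of_quantile_less[OF assms(1,2), of z] assms(3) by linarith
  qed
qed simp

lemma quantile_mono:
  assumes "0 < y" "y \<le> z" "z < 1"
  shows "quantile M y \<le> quantile M z"
  unfolding quantile_eq_Sup_cdf
  using assms by (intro cSup_subset_mono quantile_set) auto

lemma measurable_quantile [measurable]: "quantile M \<in> borel_measurable unit_lborel"
proof -
  have "quantile M \<in> borel_measurable (restrict_space borel {0<..<1})"
    by (intro borel_measurable_mono_on_fnc) (auto simp: mono_on_def intro: quantile_mono)
  moreover have "sets unit_lborel = sets (restrict_space borel {0<..<1})"
    by (simp add: unit_lborel_def sets_restrict_space)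
  ultimately show ?thesis
    using measurable_cong_sets by blast
qed

text \<open>Continuity is from the right because the supremum defining \<open>quantile\<close> runs
  over a weak inequality. This is what later gives a formula at every point rather than almost
  everywhere.\<close>

lemma quantile_right_tendsto:
  assumes "0 < y" "y < 1"
  shows "(quantile M \<longlongrightarrow> quantile M y) (at_right y)"
proof (rule order_tendstoI)
  have *: "\<forall>\<^sub>F z in at_right y. y < z \<and> z < 1"
    using assms by (auto simp: eventually_at_right_field)
  fix a assume "a < quantile M y"
  then show "\<forall>\<^sub>F z in at_right y. a < quantile M z"
    by (intro eventually_mono[OF *]) (use quantile_mono[OF assms(1)] in \<open>force intro: less_le_trans\<close>)
next
  fix a assume a: "quantile M y < a"
  \<comment> \<open>The gap between \<open>b\<close> and \<open>a\<close> compensates for the weak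
    inequality in \<open>quantile_le_of_less_cdf\<close>.\<close>
  then obtain b where b: "quantile M y < b" "b < a"
    using dense by blast
  have "y < cdf M b"
    using less_cdf_of_quantile_less[OF assms b(1)] .
  then have "\<forall>\<^sub>F z in at_right y. y < z \<and> z < 1 \<and> z < cdf M b"
    using assms by (auto simp: eventually_at_right_field intro!: exI[of _ "min 1 (cdf M b)"])
  then show "\<forall>\<^sub>F z in at_right y. quantile M z < a"
  proof eventually_elim
    case (elim z)
    then show ?case
      using quantile_le_of_less_cdf[of z b] assms(1) b(2) by linarith
  qed
qed

text \<open>Inverse transform sampling: the sublevel set of the quantile function at
  \<open>x\<close> lies between the open and the closed interval from 0 to \<open>cdf M x\<close>,
  which have equal length.\<close>

lemma distr_quantile: "distr unit_lborel borel (quantile M) = M"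
proof (rule cdf_unique)
  show "real_distribution (distr unit_lborel borel (quantile M))"
    by (auto intro!: unit_lborel.real_distribution_distr)
  show "real_distribution M" ..
  show "cdf (distr unit_lborel borel (quantile M)) = cdf M"
  proof
    fix x
    let ?Q = "{y \<in> {0<..<1}. quantile M y \<le> x}"
    have vimage: "quantile M -` {..x} \<inter> space unit_lborel = ?Q"
      by (auto simp: space_unit_lborel)
    have Q: "?Q \<in> sets unit_lborel"
      unfolding vimage[symmetric] by (rule measurable_sets[OF measurable_quantile]) simp
    then have Q': "?Q \<in> sets lborel"
      by (simp add: sets_unit_lborel)
    have "cdf (distr unit_lborel borel (quantile M)) x = measure unit_lborel ?Q"
      unfolding cdf_def vimage[symmetric] by (rule measure_distr) measurable
    also have "\<dots> = cdf M x"
    proof (rule antisym)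
      have "?Q \<subseteq> {0..cdf M x}"
        using le_cdf_of_quantile_le by force
      then have "measure lborel ?Q \<le> measure lborel {0..cdf M x}"
        using Q' by (intro measure_mono_fmeasurable fmeasurableI) (auto simp: cdf_nonneg)
      moreover have "measure unit_lborel ?Q = measure lborel ?Q"
        by (rule measure_unit_lborel) auto
      ultimately show "measure unit_lborel ?Q \<le> cdf M x"
        by (simp add: cdf_nonneg)
      have "{0<..<cdf M x} \<subseteq> ?Q"
        using cdf_bounded_prob[of x] quantile_le_of_less_cdf by force
      then have "measure unit_lborel {0<..<cdf M x} \<le> measure unit_lborel ?Q"
        using Q by (rule unit_lborel.finite_measure_mono)
      moreover have "{0<..<cdf M x} \<subseteq> {0<..<1}"
        using cdf_bounded_prob[of x] by auto
      then have "measure unit_lborel {0<..<cdf M x} = cdf M x"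
        by (simp add: measure_unit_lborel cdf_nonneg)
      ultimately show "cdf M x \<le> measure unit_lborel ?Q"
        by simp
    qed
    finally show "cdf (distr unit_lborel borel (quantile M)) x = cdf M x" .
  qed
qed

lemma integral_quantile:
  fixes f :: "real \<Rightarrow> real"
  assumes "f \<in> borel_measurable borel"
  shows "(\<integral>s. f (quantile M s) \<partial>unit_lborel) = integral\<^sup>L M f"
  using integral_distr[OF measurable_quantile assms] by (simp add: distr_quantile)

lemma integrable_quantile_iff:
  fixes f :: "real \<Rightarrow> real"
  assumes "f \<in> borel_measurable borel"
  shows "integrable unit_lborel (\<lambda>s. f (quantile M s)) \<longleftrightarrow> integrable M f"
  using integrable_distr_eq[OF measurable_quantile assms] by (simp add: distr_quantile)

end

section \<open>Integrability of quantile functions\<close>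

lemma
  assumes "\<mu> \<in> \<W>\<^sub>2"
  shows wasserstein_space_distribution: "real_distribution \<mu>"
    and wasserstein_space_integrable_sq: "integrable \<mu> (\<lambda>x. x\<^sup>2)"
    and wasserstein_space_integrable: "integrable \<mu> (\<lambda>x. x)"
proof -
  show \<mu>: "real_distribution \<mu>" and sq: "integrable \<mu> (\<lambda>x. x\<^sup>2)"
    using assms unfolding wasserstein_space_def mem_Collect_eq by (rule conjunct1, rule conjunct2)
  interpret real_distribution \<mu> by (rule \<mu>)
  show "integrable \<mu> (\<lambda>x. x)"
    by (rule square_integrable_imp_integrable) (use sq in simp_all)
qed

lemma
  assumes "\<mu> \<in> \<W>\<^sub>2"
  shows integrable_quantile: "integrable unit_lborel (quantile \<mu>)"
    and integrable_quantile_sq: "integrable unit_lborel (\<lambda>s. (quantile \<mu> s)\<^sup>2)"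
proof -
  interpret real_distribution \<mu>
    using assms by (rule wasserstein_space_distribution)
  show "integrable unit_lborel (quantile \<mu>)"
    by (rule integrable_quantile_iff[of "\<lambda>x. x", THEN iffD2])
       (measurable, rule wasserstein_space_integrable[OF assms])
  show "integrable unit_lborel (\<lambda>s. (quantile \<mu> s)\<^sup>2)"
    by (rule integrable_quantile_iff[of "\<lambda>x. x\<^sup>2", THEN iffD2])
       (measurable, rule wasserstein_space_integrable_sq[OF assms])
qed

section \<open>Distance to a measure with two atoms\<close>

text \<open>For \<open>a \<le> b\<close> and \<open>0 < t < 1\<close> this is, on the unit interval,
  the quantile function of the measure with mass \<open>t\<close> at \<open>a\<close> and
  \<open>1 - t\<close> at \<open>b\<close>.\<close>

definition step :: "real \<Rightarrow> real \<Rightarrow> real \<Rightarrow> real \<Rightarrow> real" where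
  "step a b t s = (if s < t then a else b)"

lemma measurable_step [measurable]: "step a b t \<in> borel_measurable unit_lborel"
proof -
  have "step a b t \<in> borel_measurable borel"
    unfolding step_def[abs_def] by measurable
  then show ?thesis
    by (rule measurable_unit_lborel)
qed

lemma step_eq_indicator: "step a b t = (\<lambda>s. b + (a - b) * indicator {..<t} s)"
  by (auto simp: step_def fun_eq_iff)

lemma integrable_indicator_lessThan:
  "integrable unit_lborel (indicator {..<t} :: real \<Rightarrow> real)"
proof (rule unit_lborel.integrable_const_bound[of _ 1])
  show "(indicator {..<t} :: real \<Rightarrow> real) \<in> borel_measurable unit_lborel"
    by (rule measurable_unit_lborel) measurable
qed simp

lemma integrable_step: "integrable unit_lborel (step a b t)"
  unfolding step_eq_indicator using integrable_indicator_lessThan[of t] by simp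

lemma integral_step:
  assumes "0 < t" "t < 1"
  shows "integral\<^sup>L unit_lborel (step a b t) = t * a + (1 - t) * b"
proof -
  have "{..<t} \<inter> space unit_lborel = {0<..<t}"
    using assms by (auto simp: space_unit_lborel)
  then have "integral\<^sup>L unit_lborel (indicator {..<t} :: real \<Rightarrow> real) = t"
    using assms by (simp add: measure_unit_lborel greaterThanLessThan_subseteq_greaterThanLessThan)
  then show ?thesis
    unfolding step_eq_indicator using integrable_indicator_lessThan[of t]
    by (simp add: unit_lborel.prob_space algebra_simps)
qed

lemma distr_step_wasserstein_space: "distr unit_lborel borel (step a b t) \<in> \<W>\<^sub>2"
proof -
  have "(\<lambda>s. (step a b t s)\<^sup>2) = step (a\<^sup>2) (b\<^sup>2) t"
    by (auto simp: step_def)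
  then have "integrable unit_lborel (\<lambda>s. (step a b t s)\<^sup>2)"
    by (simp only: integrable_step)
  then have "integrable (distr unit_lborel borel (step a b t)) (\<lambda>x. x\<^sup>2)"
    by (subst integrable_distr_eq[OF measurable_step]) simp_all
  then show ?thesis
    using unit_lborel.real_distribution_distr[OF measurable_step]
    by (simp add: wasserstein_space_def)
qed

lemma emeasure_distr_step:
  assumes A: "A \<in> sets borel" and t: "0 < t" "t < 1"
  shows "emeasure (distr unit_lborel borel (step a b t)) A =
    ennreal t * indicator A a + ennreal (1 - t) * indicator A b"
proof -
  let ?V = "step a b t -` A \<inter> space unit_lborel"
  have V: "?V = (if a \<in> A then {0<..<t} else {}) \<union> (if b \<in> A then {t..<1} else {})"
    using t by (auto simp: step_def space_unit_lborel split: if_splits)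
  have "emeasure (distr unit_lborel borel (step a b t)) A = emeasure unit_lborel ?V"
    using A by (simp add: emeasure_distr)
  also have "\<dots> = emeasure lborel ?V"
    by (rule emeasure_unit_lborel) (simp add: space_unit_lborel)
  also have "\<dots> = ennreal t * indicator A a + ennreal (1 - t) * indicator A b"
  proof -
    have "emeasure lborel ({0<..<t} \<union> {t..<1}) = ennreal t + ennreal (1 - t)"
      using t by (subst plus_emeasure[symmetric]) auto
    then show ?thesis
      using t unfolding V by (cases "a \<in> A"; cases "b \<in> A") simp_all
  qed
  finally show ?thesis .
qed

text \<open>The cut is the mass of the left atom, with numerator and denominator multiplied by
  \<open>exp p\<close>. Through this identity the results on \<open>step\<close> apply to the test
  measures.\<close>

lemma two_point_eq_distr_step:
  "two_point x \<sigma> p =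
     distr unit_lborel borel (step (x - \<sigma> * exp p) (x + \<sigma> * exp (-p)) (1 / (1 + exp (2 * p))))"
proof (rule measure_eqI)
  fix A assume "A \<in> sets (two_point x \<sigma> p)"
  then have A: "A \<in> sets borel" by simp
  have e: "exp (2 * p) = exp p * exp p"
    by (simp flip: exp_add)
  have pos: "0 < 1 + exp p * exp p"
    by (intro add_pos_pos mult_pos_pos) simp_all
  then have "1 + exp p * exp p \<noteq> 0" by linarith
  then have w: "exp (-p) / (exp p + exp (-p)) = 1 / (1 + exp (2 * p))"
      "exp p / (exp p + exp (-p)) = 1 - 1 / (1 + exp (2 * p))"
    by (simp_all add: e exp_minus divide_simps)
  show "emeasure (two_point x \<sigma> p) A =
      emeasure (distr unit_lborel borel
        (step (x - \<sigma> * exp p) (x + \<sigma> * exp (-p)) (1 / (1 + exp (2 * p))))) A"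
    unfolding emeasure_two_point[OF A] w
    by (subst emeasure_distr_step) (use A pos in \<open>simp_all add: e\<close>)
qed simp

text \<open>Optimality of the monotone coupling is Kantorovich duality, with potentials built from the
  positive part \<open>(c - x)\<^sup>+\<close> at the level \<open>c\<close> where the quantile function crosses the cut \<open>t\<close>.\<close>

lemma wasserstein_dist_step:
  assumes \<mu>: "\<mu> \<in> \<W>\<^sub>2" and "a \<le> b" and t: "0 < t" "t < 1"
  shows "(wasserstein_dist \<mu> (distr unit_lborel borel (step a b t)))\<^sup>2 =
    (\<integral>s. (quantile \<mu> s - step a b t s)\<^sup>2 \<partial>unit_lborel)"
proof -
  interpret real_distribution \<mu>
    using \<mu> by (rule wasserstein_space_distribution)
  define \<nu> where "\<nu> = distr unit_lborel borel (step a b t)"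
  define c where "c = quantile \<mu> t"
  \<comment> \<open>\<open>\<phi> x\<close> is the minimum of
    \<open>(x - y)\<^sup>2 - \<psi> y\<close> over the atoms \<open>y = a\<close> and
    \<open>y = b\<close>. The constant added to \<open>\<psi>\<close> at \<open>a\<close> makes the
    minimizer switch from \<open>a\<close> to \<open>b\<close> exactly at
    \<open>x = c\<close>.\<close>
  define \<phi> where "\<phi> x = x\<^sup>2 - 2 * b * x - 2 * (b - a) * max (c - x) 0" for x
  define \<psi> where "\<psi> y = y\<^sup>2 + (if y = a then 2 * (b - a) * c else 0)" for y
  have \<phi>_borel [measurable]: "\<phi> \<in> borel_measurable borel"
    and \<psi>_borel [measurable]: "\<psi> \<in> borel_measurable borel"
    unfolding \<phi>_def[abs_def] \<psi>_def[abs_def] by measurable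
  have \<phi>: "integrable \<mu> \<phi>"
    using wasserstein_space_integrable[OF \<mu>] wasserstein_space_integrable_sq[OF \<mu>]
    unfolding \<phi>_def[abs_def]
    by (intro Bochner_Integration.integrable_diff integrable_mult_right integrable_max) simp_all
  have \<psi>_step: "(\<lambda>s. \<psi> (step a b t s)) = step (\<psi> a) (\<psi> b) t"
    by (auto simp: step_def)
  have \<psi>: "integrable \<nu> \<psi>"
    unfolding \<nu>_def by (subst integrable_distr_eq) (simp_all add: \<psi>_step integrable_step)
  have duality: "\<phi> x + \<psi> y \<le> (x - y)\<^sup>2" if "y = a \<or> y = b" for x y
  proof -
    \<comment> \<open>The first bound settles \<open>y = a\<close>, the second
      \<open>y = b\<close>.\<close>
    have "(b - a) * (c - x) \<le> (b - a) * max (c - x) 0" "0 \<le> (b - a) * max (c - x) 0"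
      using \<open>a \<le> b\<close> by (intro mult_left_mono mult_nonneg_nonneg; simp)+
    then show ?thesis
      using that by (auto simp: \<phi>_def \<psi>_def power2_eq_square algebra_simps)
  qed
  \<comment> \<open>Monotonicity puts the quantile on the side of \<open>c\<close> where the minimum
    is attained at the very atom chosen by \<open>step\<close>.\<close>
  have tight: "\<phi> (quantile \<mu> s) + \<psi> (step a b t s) = (quantile \<mu> s - step a b t s)\<^sup>2"
    if "s \<in> space unit_lborel" for s
  proof (cases "s < t")
    case True
    then have "quantile \<mu> s \<le> c"
      unfolding c_def using that t by (intro quantile_mono) (simp_all add: space_unit_lborel)
    then show ?thesis
      using True by (simp add: \<phi>_def \<psi>_def step_def power2_eq_square algebra_simps)
  next
    case False
    then have "c \<le> quantile \<mu> s"
      unfolding c_def using that t by (intro quantile_mono) (simp_all add: space_unit_lborel)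
    then show ?thesis
      using False by (simp add: \<phi>_def \<psi>_def step_def power2_eq_square algebra_simps)
  qed
  let ?cost = "\<lambda>\<pi>. \<integral>(x, y). \<bar>x - y\<bar>\<^sup>2 \<partial>\<pi>"
  let ?I = "\<integral>s. (quantile \<mu> s - step a b t s)\<^sup>2 \<partial>unit_lborel"
  have dual_value: "?I = integral\<^sup>L \<mu> \<phi> + integral\<^sup>L \<nu> \<psi>"
  proof -
    have "?I = (\<integral>s. \<phi> (quantile \<mu> s) + \<psi> (step a b t s) \<partial>unit_lborel)"
      by (rule Bochner_Integration.integral_cong[OF refl]) (rule tight[symmetric])
    also have "\<dots> = (\<integral>s. \<phi> (quantile \<mu> s) \<partial>unit_lborel) + (\<integral>s. \<psi> (step a b t s) \<partial>unit_lborel)"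
      by (rule Bochner_Integration.integral_add)
         (simp_all add: \<psi>_step integrable_step integrable_quantile_iff \<phi>)
    also have "(\<integral>s. \<psi> (step a b t s) \<partial>unit_lborel) = integral\<^sup>L \<nu> \<psi>"
      unfolding \<nu>_def by (rule integral_distr[symmetric]) measurable
    also have "(\<integral>s. \<phi> (quantile \<mu> s) \<partial>unit_lborel) = integral\<^sup>L \<mu> \<phi>"
      by (rule integral_quantile) measurable
    finally show ?thesis .
  qed
  have lower: "?I \<le> ?cost \<pi>" if "\<pi> \<in> couplings \<mu> \<nu>" for \<pi>
  proof -
    have \<pi>: "sets \<pi> = sets (borel \<Otimes>\<^sub>M borel)" "distr \<pi> borel fst = \<mu>" "distr \<pi> borel snd = \<nu>"
      using that by (simp_all add: couplings_def)
    have fst: "fst \<in> measurable \<pi> borel" and snd: "snd \<in> measurable \<pi> borel"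
      using measurable_cong_sets[OF \<pi>(1) refl] measurable_fst measurable_snd by blast+
    have int_fst: "integrable \<pi> (\<lambda>z. f (fst z))" "integral\<^sup>L \<pi> (\<lambda>z. f (fst z)) = integral\<^sup>L \<mu> f"
      if "f \<in> borel_measurable borel" "integrable \<mu> f" for f :: "real \<Rightarrow> real"
      using that integrable_distr_eq[OF fst that(1)] integral_distr[OF fst that(1)]
      by (simp_all add: \<pi>(2))
    have int_snd: "integrable \<pi> (\<lambda>z. f (snd z))" "integral\<^sup>L \<pi> (\<lambda>z. f (snd z)) = integral\<^sup>L \<nu> f"
      if "f \<in> borel_measurable borel" "integrable \<nu> f" for f :: "real \<Rightarrow> real"
      using that integrable_distr_eq[OF snd that(1)] integral_distr[OF snd that(1)]
      by (simp_all add: \<pi>(3))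
    have \<nu>: "\<nu> \<in> \<W>\<^sub>2"
      unfolding \<nu>_def by (rule distr_step_wasserstein_space)
    \<comment> \<open>Without integrability the Bochner integral of the cost would default to 0 and
      the comparison below would fail.\<close>
    have cost: "integrable \<pi> (\<lambda>z. (fst z - snd z)\<^sup>2)"
    proof (rule Bochner_Integration.integrable_bound)
      show "integrable \<pi> (\<lambda>z. 2 * (fst z)\<^sup>2 + 2 * (snd z)\<^sup>2)"
        using int_fst(1)[of "\<lambda>x. x\<^sup>2"] int_snd(1)[of "\<lambda>x. x\<^sup>2"]
          wasserstein_space_integrable_sq[OF \<mu>] wasserstein_space_integrable_sq[OF \<nu>]
        by (intro Bochner_Integration.integrable_add integrable_mult_right) simp_all
      show "(\<lambda>z. (fst z - snd z)\<^sup>2) \<in> borel_measurable \<pi>"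
        using fst snd by (intro borel_measurable_power borel_measurable_diff)
      have "(x - y)\<^sup>2 \<le> 2 * x\<^sup>2 + 2 * y\<^sup>2" for x y :: real
        using zero_le_power2[of "x + y"] by (simp add: power2_eq_square algebra_simps)
      then show "AE z in \<pi>. norm ((fst z - snd z)\<^sup>2) \<le> norm (2 * (fst z)\<^sup>2 + 2 * (snd z)\<^sup>2)"
        by (intro AE_I2) simp
    qed
    \<comment> \<open>The inequality \<open>duality\<close> is available only at the two atoms,
      which carry all the mass of the second marginal.\<close>
    have "AE y in \<nu>. y = a \<or> y = b"
      unfolding \<nu>_def by (subst AE_distr_iff) (simp_all add: step_def)
    then have atoms: "AE z in \<pi>. snd z = a \<or> snd z = b"
      unfolding \<pi>(3)[symmetric] by (subst (asm) AE_distr_iff[OF snd]) simp_all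
    have "?I = (\<integral>z. \<phi> (fst z) + \<psi> (snd z) \<partial>\<pi>)"
      unfolding dual_value
      using int_fst[OF \<phi>_borel \<phi>] int_snd[OF \<psi>_borel \<psi>] by simp
    also have "\<dots> \<le> (\<integral>z. (fst z - snd z)\<^sup>2 \<partial>\<pi>)"
    proof (rule integral_mono_AE[OF _ cost])
      show "integrable \<pi> (\<lambda>z. \<phi> (fst z) + \<psi> (snd z))"
        using int_fst(1)[OF \<phi>_borel \<phi>] int_snd(1)[OF \<psi>_borel \<psi>] by simp
      show "AE z in \<pi>. \<phi> (fst z) + \<psi> (snd z) \<le> (fst z - snd z)\<^sup>2"
        using atoms by eventually_elim (rule duality)
    qed
    also have "\<dots> = ?cost \<pi>"
      by (simp add: case_prod_beta')
    finally show ?thesis .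
  qed
  \<comment> \<open>The minimizer is the monotone coupling, the joint law of the two quantile
    functions on the unit interval.\<close>
  have attained: "?I \<in> ?cost ` couplings \<mu> \<nu>"
  proof
    let ?g = "\<lambda>s. (quantile \<mu> s, step a b t s)"
    let ?\<pi> = "distr unit_lborel (borel \<Otimes>\<^sub>M borel) ?g"
    have g: "?g \<in> measurable unit_lborel (borel \<Otimes>\<^sub>M borel)"
      by (rule measurable_Pair) measurable
    have "distr ?\<pi> borel fst = \<mu>" "distr ?\<pi> borel snd = \<nu>"
      unfolding \<nu>_def by (simp_all add: distr_distr[OF _ g] comp_def distr_quantile)
    then show "?\<pi> \<in> couplings \<mu> \<nu>"
      unfolding couplings_def using unit_lborel.prob_space_distr[OF g] by simp
    have "?cost ?\<pi> = (\<integral>s. (case ?g s of (x, y) \<Rightarrow> \<bar>x - y\<bar>\<^sup>2) \<partial>unit_lborel)"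
      by (rule integral_distr[OF g]) measurable
    then show "?I = ?cost ?\<pi>" by simp
  qed
  have "(INF \<pi>\<in>couplings \<mu> \<nu>. ?cost \<pi>) = ?I"
    using attained lower by (intro cInf_eq_minimum) blast+
  then show ?thesis
    unfolding wasserstein_dist_def \<nu>_def by simp
qed

text \<open>Writing \<open>step\<close> as \<open>b\<close> minus \<open>b - a\<close> times the
  indicator of the points below \<open>t\<close> splits the cross term into the full and the partial
  integral of \<open>F\<close>.\<close>

lemma integral_diff_step_sq:
  assumes F: "integrable unit_lborel F" and F2: "integrable unit_lborel (\<lambda>s. (F s)\<^sup>2)"
    and t: "0 < t" "t < 1"
  shows "(\<integral>s. (F s - step a b t s)\<^sup>2 \<partial>unit_lborel) =
    (\<integral>s. (F s)\<^sup>2 \<partial>unit_lborel) - 2 * b * (LBINT s:{0<..<1}. F s)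
    + 2 * (b - a) * (LBINT s:{0<..<t}. F s) + t * a\<^sup>2 + (1 - t) * b\<^sup>2"
proof -
  let ?G = "\<lambda>s. indicator {0<..<t} s * F s"
  have F': "set_integrable lborel {0<..<t} F"
    using F unfolding integrable_unit_lborel by (rule set_integrable_subset) (use t in auto)
  have ind: "indicator {0<..<1} s *\<^sub>R ?G s = indicator {0<..<t} s *\<^sub>R F s" for s
    using t by (auto simp: indicator_def)
  have G: "integrable unit_lborel ?G"
    using F' unfolding integrable_unit_lborel set_integrable_def ind .
  have G_eq: "integral\<^sup>L unit_lborel ?G = (LBINT s:{0<..<t}. F s)"
    unfolding integral_unit_lborel set_lebesgue_integral_def ind ..
  have "(\<integral>s. (F s - step a b t s)\<^sup>2 \<partial>unit_lborel) =
      (\<integral>s. (F s)\<^sup>2 - 2 * b * F s + 2 * (b - a) * ?G s + step (a\<^sup>2) (b\<^sup>2) t s \<partial>unit_lborel)"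
    by (rule Bochner_Integration.integral_cong)
       (auto simp: space_unit_lborel step_def power2_eq_square algebra_simps)
  also have "\<dots> = (\<integral>s. (F s)\<^sup>2 \<partial>unit_lborel) - 2 * b * integral\<^sup>L unit_lborel F
      + 2 * (b - a) * integral\<^sup>L unit_lborel ?G + integral\<^sup>L unit_lborel (step (a\<^sup>2) (b\<^sup>2) t)"
    using F F2 G integrable_step[of "a\<^sup>2" "b\<^sup>2" t] by simp
  finally show ?thesis
    unfolding G_eq integral_step[OF t] integral_unit_lborel[of F] by simp
qed

text \<open>The measure \<open>two_point x \<sigma> p\<close> has mean \<open>x\<close> and variance
  \<open>\<sigma>\<^sup>2\<close> whatever \<open>p\<close> is, so \<open>p\<close> enters only
  through the last term. That term exposes the partial integral, with the gap between the atoms as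
  its factor.\<close>

lemma wasserstein_dist_two_point:
  assumes \<mu>: "\<mu> \<in> \<W>\<^sub>2" and "0 \<le> \<sigma>"
  shows "(wasserstein_dist \<mu> (two_point x \<sigma> p))\<^sup>2 =
    (\<integral>s. (quantile \<mu> s)\<^sup>2 \<partial>unit_lborel) - 2 * x * center_of_mass \<mu> + x\<^sup>2 + \<sigma>\<^sup>2
    - 2 * \<sigma> * (exp (-p) * center_of_mass \<mu>
        - (exp p + exp (-p)) * (LBINT s:{0<..<1 / (1 + exp (2 * p))}. quantile \<mu> s))"
proof -
  define E where "E = exp p"
  have E: "E > 0" "exp (-p) = 1 / E" "exp (2 * p) = E * E" "exp p = E"
    by (simp_all add: E_def exp_minus inverse_eq_divide flip: exp_add)
  have pos: "0 < 1 + E * E"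
    using E(1) by (intro add_pos_pos mult_pos_pos) simp_all
  have t: "0 < 1 / (1 + E * E)" "1 / (1 + E * E) < 1"
    using E(1) pos by simp_all
  have le: "x - \<sigma> * E \<le> x + \<sigma> * (1 / E)"
    using E(1) \<open>0 \<le> \<sigma>\<close> by (smt (verit) divide_nonneg_pos mult_nonneg_nonneg)
  have "1 + E * E \<noteq> 0" using pos by linarith
  then have sq: "1 / (1 + E * E) * (x - \<sigma> * E)\<^sup>2 + (1 - 1 / (1 + E * E)) * (x + \<sigma> * (1 / E))\<^sup>2
      = x\<^sup>2 + \<sigma>\<^sup>2"
    using E(1) by (simp add: divide_simps power2_eq_square) (simp add: algebra_simps)
  show ?thesis
    unfolding two_point_eq_distr_step E(2,3,4) wasserstein_dist_step[OF \<mu> le t]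
      integral_diff_step_sq[OF integrable_quantile[OF \<mu>] integrable_quantile_sq[OF \<mu>] t]
      center_of_mass_def
    using sq by (simp add: algebra_simps)
qed

section \<open>The exotic isometries\<close>

lemma set_integrable_quantile:
  assumes "\<mu> \<in> \<W>\<^sub>2" "A \<in> sets borel" "A \<subseteq> {0<..<1}"
  shows "set_integrable lborel A (quantile \<mu>)"
  using integrable_quantile[OF assms(1)] unfolding integrable_unit_lborel
  by (rule set_integrable_subset) (use assms in simp_all)

text \<open>Right derivatives are taken within a half-open interval, since the chain rule for images
  and the transfer between functions agreeing on a set both want an explicit set.\<close>

lemma at_within_Ico_at_right:
  fixes y z :: real
  assumes "y < z"
  shows "at y within {y..<z} = at_right y"
  by (rule at_within_nhd[of y "{..<z}"]) (use assms in auto)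

text \<open>The difference quotient is the mean of a monotone function over \<open>{y..<u}\<close>,
  hence between its values at \<open>y\<close> and \<open>u\<close>; right continuity closes the
  sandwich.\<close>

lemma integral_quantile_right_derivative:
  assumes \<mu>: "\<mu> \<in> \<W>\<^sub>2" and y: "0 < y" "y < 1"
  shows "((\<lambda>u. LBINT s:{0<..<u}. quantile \<mu> s) has_field_derivative quantile \<mu> y)
    (at y within {y..<1})"
proof -
  interpret real_distribution \<mu>
    using \<mu> by (rule wasserstein_space_distribution)
  let ?A = "\<lambda>u. LBINT s:{0<..<u}. quantile \<mu> s"
  have bounds: "quantile \<mu> y \<le> (?A u - ?A y) / (u - y)" "(?A u - ?A y) / (u - y) \<le> quantile \<mu> u"
    if u: "y < u" "u < 1" for u
  proof -
    have int: "set_integrable lborel {y..<u} (quantile \<mu>)"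
      by (rule set_integrable_quantile[OF \<mu>]) (use y u in \<open>simp_all add: subset_eq\<close>)
    have "{0<..<u} = {0<..<y} \<union> {y..<u}"
      using y u by auto
    moreover have "(LBINT s:{0<..<y} \<union> {y..<u}. quantile \<mu> s) = ?A y + (LBINT s:{y..<u}. quantile \<mu> s)"
      by (rule set_integral_Un[OF _ set_integrable_quantile[OF \<mu>] int]) (use y in auto)
    ultimately have diff: "?A u - ?A y = (LBINT s:{y..<u}. quantile \<mu> s)"
      by simp
    have const: "(LBINT s:{y..<u}. c) = (u - y) * c" "set_integrable lborel {y..<u} (\<lambda>_. c)" for c :: real
      using u by (simp_all add: set_integral_const set_integrable_def)
    have "(LBINT s:{y..<u}. quantile \<mu> y) \<le> (LBINT s:{y..<u}. quantile \<mu> s)"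
      by (rule set_integral_mono[OF const(2) int], rule quantile_mono) (use y u in simp_all)
    then show "quantile \<mu> y \<le> (?A u - ?A y) / (u - y)"
      using u unfolding diff const(1) by (simp add: field_simps)
    have "(LBINT s:{y..<u}. quantile \<mu> s) \<le> (LBINT s:{y..<u}. quantile \<mu> u)"
      by (rule set_integral_mono[OF int const(2)], rule quantile_mono) (use y u in simp_all)
    then show "(?A u - ?A y) / (u - y) \<le> quantile \<mu> u"
      using u unfolding diff const(1) by (simp add: field_simps)
  qed
  have near: "\<forall>\<^sub>F u in at_right y. y < u \<and> u < 1"
    using y by (auto simp: eventually_at_right_field)
  have "((\<lambda>u. (?A u - ?A y) / (u - y)) \<longlongrightarrow> quantile \<mu> y) (at_right y)"
  proof (rule tendsto_sandwich)
    show "\<forall>\<^sub>F u in at_right y. quantile \<mu> y \<le> (?A u - ?A y) / (u - y)"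
      by (rule eventually_mono[OF near]) (use bounds(1) in blast)
    show "\<forall>\<^sub>F u in at_right y. (?A u - ?A y) / (u - y) \<le> quantile \<mu> u"
      by (rule eventually_mono[OF near]) (use bounds(2) in blast)
    show "(quantile \<mu> \<longlongrightarrow> quantile \<mu> y) (at_right y)"
      using y by (rule quantile_right_tendsto)
  qed (rule tendsto_const)
  then show ?thesis
    using y by (simp add: has_field_derivative_iff at_within_Ico_at_right)
qed

section \<open>The change of variable \<open>hq\<close>\<close>

lemma hq_denominator_pos:
  fixes q x :: real
  assumes "0 < x" "x < 1"
  shows "0 < 1 + (exp (2 * q) - 1) * x"
proof -
  have "0 < (1 - x) + exp (2 * q) * x"
    using assms by (intro add_pos_pos mult_pos_pos) simp_all
  then show ?thesis by (simp add: algebra_simps)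
qed

lemma hq_bounds:
  assumes "0 < x" "x < 1"
  shows "0 < hq q x" "hq q x < 1"
  using assms hq_denominator_pos[OF assms, of q]
  by (simp_all add: hq_def) (simp_all add: algebra_simps)

text \<open>After cross-multiplication the products \<open>x * u\<close> cancel. Monotonicity lets
  right derivatives be composed with \<open>hq\<close>.\<close>

lemma hq_mono:
  assumes "0 < x" "x \<le> u" "u < 1"
  shows "hq q x \<le> hq q u"
proof -
  have "x * exp (2 * q) * (1 + (exp (2 * q) - 1) * u) \<le> u * exp (2 * q) * (1 + (exp (2 * q) - 1) * x)"
    using assms by (simp add: algebra_simps)
  then show ?thesis
    using assms hq_denominator_pos[of x q] hq_denominator_pos[of u q]
    by (simp add: hq_def frac_le_eq divide_le_0_iff)
qed

lemma hq_has_field_derivative: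
  assumes "0 < x" "x < 1"
  shows "(hq q has_field_derivative exp (2 * q) / (1 + (exp (2 * q) - 1) * x)\<^sup>2) (at x within S)"
  unfolding hq_def[abs_def] using hq_denominator_pos[OF assms, of q]
  by (auto intro!: derivative_eq_intros simp: power2_eq_square algebra_simps)

text \<open>Shifting \<open>p\<close> by \<open>q\<close> divides the odds of the left atom by
  \<open>exp (2 * q)\<close>, and \<open>hq q\<close> undoes this on masses: the test measure with
  cut \<open>hq q x\<close> is sent to one with cut \<open>x\<close>. Equality of the two distances
  is then linear in both partial integrals.\<close>

lemma exotic_isometry_integral_quantile:
  assumes \<Phi>: "exotic_isometry q \<Phi>" and \<mu>: "\<mu> \<in> \<W>\<^sub>2" and x: "0 < x" "x < 1"
  shows "(LBINT s:{0<..<x}. quantile (\<Phi> \<mu>) s) =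
    (1 - exp q) * center_of_mass \<mu> * x
    + exp (-q) * (1 + (exp (2 * q) - 1) * x) * (LBINT s:{0<..<hq q x}. quantile \<mu> s)"
proof -
  have \<nu>: "\<Phi> \<mu> \<in> \<W>\<^sub>2"
    using \<Phi> \<mu> by (auto simp: exotic_isometry_def isometry_W2_def)
  have two_point: "two_point z \<sigma> p \<in> \<W>\<^sub>2" for z \<sigma> p
    unfolding two_point_eq_distr_step by (rule distr_step_wasserstein_space)
  have dist: "(wasserstein_dist (\<Phi> \<mu>) (two_point z \<sigma> (p + q)))\<^sup>2 = (wasserstein_dist \<mu> (two_point z \<sigma> p))\<^sup>2"
    if "0 \<le> \<sigma>" for z \<sigma> p
    using \<Phi> \<mu> two_point that unfolding exotic_isometry_def isometry_W2_def by metis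
  \<comment> \<open>The arguments of \<open>dist\<close> come in the order \<open>\<sigma>\<close>,
    \<open>z\<close>, \<open>p\<close>. The fixed Dirac mass at 0 gives the second moment here, the
    one at 1 then gives the mean.\<close>
  have S: "(\<integral>s. (quantile (\<Phi> \<mu>) s)\<^sup>2 \<partial>unit_lborel) = (\<integral>s. (quantile \<mu> s)\<^sup>2 \<partial>unit_lborel)"
    using dist[of 0 0 0] by (simp add: wasserstein_dist_two_point \<mu> \<nu>)
  have M: "center_of_mass (\<Phi> \<mu>) = center_of_mass \<mu>"
    using dist[of 0 1 0] by (simp add: wasserstein_dist_two_point \<mu> \<nu> S)
  \<comment> \<open>Obtained by solving \<open>1 / (1 + exp (2 * (p + q))) = x\<close> for
    \<open>p\<close>.\<close>
  define p where "p = ln ((1 - x) / x) / 2 - q"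
  have p: "exp (2 * (p + q)) = (1 - x) / x"
    using x by (simp add: p_def)
  have cut_\<nu>: "1 / (1 + exp (2 * (p + q))) = x"
    unfolding p using x by (simp add: field_simps)
  have "exp (2 * p) * exp (2 * q) = (1 - x) / x"
    unfolding p[symmetric] by (simp add: algebra_simps flip: exp_add)
  then have p': "exp (2 * p) = (1 - x) / (x * exp (2 * q))"
    using x by (simp add: field_simps)
  have cut_\<mu>: "1 / (1 + exp (2 * p)) = hq q x"
    unfolding p' hq_def using x hq_denominator_pos[OF x, of q] by (simp add: field_simps)
  define m where "m = center_of_mass \<mu>"
  define A where "A = (LBINT s:{0<..<hq q x}. quantile \<mu> s)"
  define B where "B = (LBINT s:{0<..<x}. quantile (\<Phi> \<mu>) s)"
  define E where "E = exp (p + q)"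
  define Q where "Q = exp q"
  have "exp (-(p + q)) * m - (exp (p + q) + exp (-(p + q))) * B = exp (-p) * m - (exp p + exp (-p)) * A"
    using dist[of 1 0 p] unfolding wasserstein_dist_two_point[OF \<mu> zero_le_one]
      wasserstein_dist_two_point[OF \<nu> zero_le_one] S M cut_\<mu> cut_\<nu> m_def A_def B_def
    by simp
  moreover have E: "E > 0" "Q > 0" "exp (-(p + q)) = 1 / E" "exp p = E / Q" "exp (-p) = Q / E"
    by (simp_all add: E_def Q_def exp_add exp_diff exp_minus field_simps)
  ultimately have "1 / E * m - (E + 1 / E) * B = Q / E * m - (E / Q + Q / E) * A"
    by (simp add: E_def)
  \<comment> \<open>The factor leaves \<open>E\<close> only in the form \<open>E * E\<close>, which
    is the rational expression \<open>(1 - x) / x\<close>; a further factor \<open>x\<close> then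
    clears denominators.\<close>
  then have "E * (1 / E * m - (E + 1 / E) * B) = E * (Q / E * m - (E / Q + Q / E) * A)"
    by (rule arg_cong)
  then have "m - (E * E + 1) * B = Q * m - (E * E / Q + Q) * A"
    using E(1) by (simp add: algebra_simps)
  moreover have "E * E = (1 - x) / x"
    unfolding p[symmetric] E_def by (simp flip: exp_add)
  ultimately have "x * (m - ((1 - x) / x + 1) * B) = x * (Q * m - ((1 - x) / x / Q + Q) * A)"
    by simp
  then have "B = (1 - Q) * m * x + ((1 - x) / Q + Q * x) * A"
    using x by (simp add: algebra_simps diff_divide_distrib)
  moreover have "exp (-q) = 1 / Q" "exp (2 * q) = Q * Q"
    by (simp_all add: Q_def exp_minus inverse_eq_divide flip: exp_add)
  moreover have "(1 - x) / Q + Q * x = 1 / Q * (1 + (Q * Q - 1) * x)"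
    using E(2) by (simp add: field_simps)
  ultimately show ?thesis
    by (simp only: A_def B_def m_def Q_def)
qed

theorem theorem3p18:
  fixes q :: real and \<Phi> :: "real measure \<Rightarrow> real measure"
  assumes "exotic_isometry q \<Phi>"
  shows "\<forall>\<mu>\<in>\<W>\<^sub>2. \<forall>x. 0 < x \<and> x < 1 \<longrightarrow>
    quantile (\<Phi> \<mu>) x =
      (1 - exp q) * center_of_mass \<mu>
      + (exp q + (exp (-q) - exp q) * hq q x) * quantile \<mu> (hq q x)
      + (exp q - exp (-q)) * (LBINT s:{0<..<hq q x}. quantile \<mu> s)"
proof (intro ballI allI impI)
  fix \<mu> :: "real measure" and x :: real
  assume \<mu>: "\<mu> \<in> \<W>\<^sub>2" and "0 < x \<and> x < 1"
  then have x: "0 < x" "x < 1" by simp_all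
  have \<nu>: "\<Phi> \<mu> \<in> \<W>\<^sub>2"
    using assms \<mu> by (auto simp: exotic_isometry_def isometry_W2_def)
  let ?A = "\<lambda>u. LBINT s:{0<..<u}. quantile \<mu> s"
  let ?D = "\<lambda>u. 1 + (exp (2 * q) - 1) * u"
  let ?R = "\<lambda>u. (1 - exp q) * center_of_mass \<mu> * u + exp (-q) * ?D u * ?A (hq q u)"
  \<comment> \<open>The chain rule asks for the derivative within the image of
    \<open>{x..<1}\<close>, which monotonicity keeps to the right of \<open>hq q x\<close>, where
    the one-sided derivative is known.\<close>
  have "(?A has_field_derivative quantile \<mu> (hq q x)) (at (hq q x) within hq q ` {x..<1})"
  proof (rule DERIV_subset)
    show "(?A has_field_derivative quantile \<mu> (hq q x)) (at (hq q x) within {hq q x..<1})"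
      using hq_bounds[OF x] by (rule integral_quantile_right_derivative[OF \<mu>])
    show "hq q ` {x..<1} \<subseteq> {hq q x..<1}"
      using hq_mono[OF x(1)] hq_bounds(2) x(1) by fastforce
  qed
  from DERIV_image_chain[OF this hq_has_field_derivative[OF x]]
  have [derivative_intros]: "((\<lambda>u. ?A (hq q u)) has_field_derivative
      quantile \<mu> (hq q x) * (exp (2 * q) / (?D x)\<^sup>2)) (at x within {x..<1})"
    by (simp add: comp_def)
  have "(?R has_field_derivative (1 - exp q) * center_of_mass \<mu>
      + (exp (-q) * (exp (2 * q) - 1) * ?A (hq q x)
        + exp (-q) * ?D x * (quantile \<mu> (hq q x) * (exp (2 * q) / (?D x)\<^sup>2)))) (at x within {x..<1})"
    by (auto intro!: derivative_eq_intros)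
  moreover have "(?R has_field_derivative quantile (\<Phi> \<mu>) x) (at x within {x..<1})"
    using integral_quantile_right_derivative[OF \<nu> x]
    by (rule has_field_derivative_transform_within[OF _ zero_less_one])
       (use x exotic_isometry_integral_quantile[OF assms \<mu>] in simp_all)
  \<comment> \<open>Derivatives within a set are unique only at a limit point of that set.\<close>
  moreover have "at x within {x..<1} \<noteq> bot"
    using x by (simp add: at_within_Ico_at_right)
  ultimately have deriv: "quantile (\<Phi> \<mu>) x = (1 - exp q) * center_of_mass \<mu>
      + (exp (-q) * (exp (2 * q) - 1) * ?A (hq q x)
        + exp (-q) * ?D x * (quantile \<mu> (hq q x) * (exp (2 * q) / (?D x)\<^sup>2)))"
    using has_field_derivative_unique by blast
  have c1: "exp (-q) * (exp (2 * q) - 1) = exp q - exp (-q)"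
    by (simp add: algebra_simps flip: exp_add)
  \<comment> \<open>Both sides equal \<open>exp q / ?D x\<close>.\<close>
  have c2: "exp (-q) * ?D x * (exp (2 * q) / (?D x)\<^sup>2) = exp q + (exp (-q) - exp q) * hq q x"
  proof -
    have "exp (-q) = 1 / exp q" "exp (2 * q) = exp q * exp q"
      by (simp_all add: exp_minus inverse_eq_divide flip: exp_add)
    then show ?thesis
      using hq_denominator_pos[OF x, of q]
      by (simp add: hq_def power2_eq_square divide_simps) (simp add: algebra_simps)
  qed
  show "quantile (\<Phi> \<mu>) x =
      (1 - exp q) * center_of_mass \<mu>
      + (exp q + (exp (-q) - exp q) * hq q x) * quantile \<mu> (hq q x)
      + (exp q - exp (-q)) * (LBINT s:{0<..<hq q x}. quantile \<mu> s)"
    unfolding deriv c1[symmetric] c2[symmetric] by (simp only: mult_ac add_ac)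
qed

end
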